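(* Let $Q$ be a real $m\times n$ matrix with $Q^TQ=I_n$, leverage scores $\ell_j=\|e_j^TQ\|_2^2$, $1\le j\le m$, and coherence $\mu=\max_{1\le j\le m}\ell_j$, and let $L=\operatorname{diag}(\ell_1,\dots,\ell_m)$. Label the leverage scores in non-increasing order, $\mu=\ell_{[1]}\ge\cdots\ge\ell_{[m]}$. If $t\equiv\lfloor 1/\mu\rfloor$, then $$\|Q^TLQ\|_2\le\mu\sum_{j=1}^t\ell_{[j]}+(1-t\,\mu)\,\ell_{[t+1]}\le\mu.$$ If, in addition, $1/\mu$ is an integer, then $\|Q^TLQ\|_2\le\mu\sum_{j=1}^t\ell_{[j]}$.
   Context: Here $e_1,\dots,e_m$ are the canonical (column) basis vectors of $\mathbb{R}^m$ and $\|\cdot\|_2$ is the Euclidean two-norm (for vectors and matrices). If $t=m$ (which forces $1-t\mu=0$), the term $(1-t\mu)\,\ell_{[t+1]}$ is interpreted as $0$. *)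

theory Defs
  imports "HOL-Analysis.Analysis"
begin

definition leverage :: "real^'n^'m \<Rightarrow> 'm \<Rightarrow> real" where
  "leverage Q j = (norm (axis j 1 v* Q))\<^sup>2"

definition coherence :: "real^'n^'m \<Rightarrow> real" where
  "coherence Q = Max (range (leverage Q))"

definition diag :: "('m \<Rightarrow> real) \<Rightarrow> real^'m^'m" where
  "diag d = (\<chi> i j. if i = j then d i else 0)"

text \<open>The matrix two-norm is the operator norm induced by the Euclidean norms;
  the instance \<open>norm\<close> on \<open>real^'n^'m\<close> is the Frobenius norm.\<close>

definition norm2 :: "real^'n^'m \<Rightarrow> real" where
  "norm2 A = onorm (\<lambda>x. A *v x)"

text \<open>A labelling \<open>\<sigma>\<close> lists the index type as \<open>\<sigma> 1, \<dots>, \<sigma> m\<close> with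
  non-increasing values of \<open>f\<close>, so that \<open>f (\<sigma> k)\<close> is the \<open>k\<close>-th largest value
  (with multiplicity). With ties \<open>\<sigma>\<close> is not unique, but the values \<open>f (\<sigma> k)\<close> are.
  The values of \<open>\<sigma>\<close> outside \<open>{1..m}\<close> are arbitrary.\<close>

definition nonincreasing_labelling :: "('m::finite \<Rightarrow> real) \<Rightarrow> (nat \<Rightarrow> 'm) \<Rightarrow> bool" where
  "nonincreasing_labelling f \<sigma> \<longleftrightarrow>
     bij_betw \<sigma> {1..CARD('m)} UNIV \<and>
     (\<forall>i j. 1 \<le> i \<and> i \<le> j \<and> j \<le> CARD('m) \<longrightarrow> f (\<sigma> j) \<le> f (\<sigma> i))"

lemma nonincreasing_labelling_exists:
  fixes f :: "'m::finite \<Rightarrow> real"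
  shows "\<exists>\<sigma>. nonincreasing_labelling f \<sigma>"
proof -
  obtain xs0 :: "'m list" where xs0: "set xs0 = UNIV" "distinct xs0"
    using finite_distinct_list[OF finite, of "UNIV :: 'm set"] by blast
  define xs where "xs = sort_key (\<lambda>x. - f x) xs0"
  have xs: "set xs = UNIV" "distinct xs" "sorted (map (\<lambda>x. - f x) xs)"
    using xs0 by (simp_all add: xs_def)
  have len: "length xs = CARD('m)"
    using distinct_card[OF xs(2)] xs(1) by simp
  have 1: "bij_betw (\<lambda>k. k - 1) {1..CARD('m)} {..<CARD('m)}"
    by (rule bij_betw_byWitness[where f' = Suc]) auto
  have 2: "bij_betw ((!) xs) {..<CARD('m)} UNIV"
    by (rule bij_betw_nth) (use xs(1,2) len in simp_all)
  have "bij_betw (\<lambda>k. xs ! (k - 1)) {1..CARD('m)} UNIV"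
    using bij_betw_trans[OF 1 2] by (simp add: o_def)
  moreover have "f (xs ! (j - 1)) \<le> f (xs ! (i - 1))"
    if "1 \<le> i \<and> i \<le> j \<and> j \<le> CARD('m)" for i j
  proof -
    have k: "i - 1 \<le> j - 1" "i - 1 < length xs" "j - 1 < length xs"
      using that len by linarith+
    then show ?thesis
      using sorted_nth_mono[OF xs(3) k(1)] by simp
  qed
  ultimately have "nonincreasing_labelling f (\<lambda>k. xs ! (k - 1))"
    unfolding nonincreasing_labelling_def by blast
  then show ?thesis by blast
qed

end

theory Submission
  imports Defs
begin

text \<open>Put \<open>y = Q x\<close>. Then \<open>x\<^sup>T Q\<^sup>T L Q x = (\<Sum>j. l j * (y j)\<^sup>2)\<close>, where
  the weights \<open>(y j)\<^sup>2\<close> add up to the squared norm of \<open>x\<close> because \<open>Q\<close> is an isometry, and each of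
  them is at most \<open>\<mu>\<close> times that squared norm by Cauchy-Schwarz applied to row \<open>j\<close> of \<open>Q\<close>.
  Under these constraints the sum is largest when the \<open>t\<close> largest scores get the full weight
  \<open>\<mu>\<close> and the next score gets the remainder \<open>1 - t \<mu>\<close>.\<close>

text \<open>The multiplier \<open>b\<close> separates the values of \<open>f\<close> on \<open>T\<close> from those off \<open>T\<close>, so
  \<open>f j * w j \<le> b * w j\<close> off \<open>T\<close> and \<open>f j * w j \<le> b * w j + (f j - b) * c\<close> on \<open>T\<close>.\<close>
lemma capped_weighted_sum_le:
  fixes f w :: "'a \<Rightarrow> real"
  assumes "finite S" "T \<subseteq> S"
    and ge: "\<And>j. j \<in> T \<Longrightarrow> b \<le> f j"
    and le: "\<And>j. j \<in> S - T \<Longrightarrow> f j \<le> b"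
    and nonneg: "\<And>j. j \<in> S \<Longrightarrow> 0 \<le> w j"
    and cap: "\<And>j. j \<in> S \<Longrightarrow> w j \<le> c"
  shows "(\<Sum>j\<in>S. f j * w j) \<le> c * (\<Sum>j\<in>T. f j) + (sum w S - real (card T) * c) * b"
proof -
  have "f j * w j \<le> b * w j + (if j \<in> T then (f j - b) * c else 0)" if "j \<in> S" for j
  proof (cases "j \<in> T")
    case True
    have "(f j - b) * w j \<le> (f j - b) * c"
      using ge[OF True] cap[OF that] by (intro mult_left_mono) auto
    with True show ?thesis by (simp add: algebra_simps)
  next
    case False
    then show ?thesis
      using le[of j] nonneg[OF that] that by (simp add: mult_right_mono)
  qed
  then have "(\<Sum>j\<in>S. f j * w j) \<le> (\<Sum>j\<in>S. b * w j + (if j \<in> T then (f j - b) * c else 0))"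
    by (rule sum_mono)
  also have "\<dots> = b * sum w S + (\<Sum>j\<in>T. (f j - b) * c)"
    using assms(1,2) by (simp add: sum.distrib sum_distrib_left sum.inter_restrict[symmetric] Int_absorb1)
  also have "\<dots> = c * (\<Sum>j\<in>T. f j) + (sum w S - real (card T) * c) * b"
    by (simp add: sum_distrib_left sum_subtractf algebra_simps)
  finally show ?thesis .
qed

lemma norm_sq_vec: "(norm (x::real^'n))\<^sup>2 = (\<Sum>i\<in>UNIV. (x $ i)\<^sup>2)"
  unfolding power2_norm_eq_inner inner_vec_def by (simp add: power2_eq_square)

lemma inner_transpose_mult:
  fixes A :: "real^'n^'m"
  shows "x \<bullet> (transpose A *v y) = (A *v x) \<bullet> y"
  by (metis dot_lmul_matrix inner_commute transpose_matrix_vector)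

text \<open>For \<open>z = transpose R ** R *v x\<close>, moving one \<open>transpose R\<close>
  across the inner product gives \<open>z \<bullet> z = (R *v z) \<bullet> (R *v x)\<close>.
  Cauchy-Schwarz and the bound at both \<open>z\<close> and \<open>x\<close> leave a common factor
  \<open>norm z\<close> to cancel, so no eigenvalues are involved.\<close>

lemma norm2_transpose_mult_self_le:
  fixes R :: "real^'n^'m"
  assumes bound: "\<And>x. (norm (R *v x))\<^sup>2 \<le> B * (norm x)\<^sup>2"
  shows "norm2 (transpose R ** R) \<le> B"
  unfolding norm2_def
proof (rule onorm_le)
  fix x
  define z where "z = transpose R ** R *v x"
  \<comment> \<open>The bound at a unit vector forces the sign of \<open>B\<close>, which the square
    roots and the case \<open>z = 0\<close> rely on.\<close>
  have B: "0 \<le> B"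
    using order_trans[OF zero_le_power2 bound[of "axis undefined 1"]] by (simp add: norm_axis_1)
  have R: "norm (R *v u) \<le> sqrt B * norm u" for u
    using real_le_rsqrt[OF bound[of u]] by (simp add: real_sqrt_mult)
  have "norm z * norm z = z \<bullet> z"
    by (simp add: dot_square_norm power2_eq_square)
  also have "\<dots> = (R *v z) \<bullet> (R *v x)"
    using inner_transpose_mult[of z R "R *v x"] by (simp add: z_def matrix_vector_mul_assoc)
  also have "\<dots> \<le> norm (R *v z) * norm (R *v x)"
    by (rule norm_cauchy_schwarz)
  also have "\<dots> \<le> (sqrt B * norm z) * (sqrt B * norm x)"
    by (intro mult_mono R) (use B in auto)
  also have "\<dots> = (B * norm x) * norm z"
    using B by (simp add: mult_ac)
  finally have "norm z * norm z \<le> (B * norm x) * norm z" .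
  then show "norm (transpose R ** R *v x) \<le> B * norm x"
    using B unfolding z_def[symmetric] by (cases "z = 0") auto
qed

lemma transpose_diag [simp]: "transpose (diag d) = diag d"
  by (auto simp: transpose_def diag_def vec_eq_iff)

lemma diag_mult_vec: "diag d *v x = (\<chi> i. d i * x $ i)"
  by (simp add: diag_def matrix_vector_mult_def vec_eq_iff if_distrib[where f = "\<lambda>a. a * _"]
      cong: if_cong)

lemma diag_mult_diag: "diag d ** diag e = diag (\<lambda>i. d i * e i)"
  by (simp add: matrix_eq flip: matrix_vector_mul_assoc)
     (simp add: diag_mult_vec vec_eq_iff)

text \<open>Splitting \<open>diag d\<close> into two factors
  \<open>diag (\<lambda>j. sqrt (d j))\<close> turns the matrix into a Gram matrix
  \<open>transpose R ** R\<close>, and the weighted sum is then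
  \<open>(norm (R *v x))\<^sup>2\<close>.\<close>

lemma norm2_weighted_gram_le:
  fixes Q :: "real^'n^'m"
  assumes "\<And>j. 0 \<le> d j"
    and bound: "\<And>x. (\<Sum>j\<in>UNIV. d j * ((Q *v x) $ j)\<^sup>2) \<le> B * (norm x)\<^sup>2"
  shows "norm2 (transpose Q ** diag d ** Q) \<le> B"
proof -
  define R where "R = diag (\<lambda>j. sqrt (d j)) ** Q"
  have "diag (\<lambda>j. sqrt (d j)) ** diag (\<lambda>j. sqrt (d j)) = diag d"
    using assms(1) by (simp add: diag_mult_diag)
  then have "transpose Q ** diag d ** Q = transpose R ** R"
    by (metis R_def matrix_mul_assoc matrix_transpose_mul transpose_diag)
  moreover have "(norm (R *v x))\<^sup>2 \<le> B * (norm x)\<^sup>2" for x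
    using bound[of x] assms(1) unfolding norm_sq_vec[of "R *v x"]
    by (simp add: R_def diag_mult_vec power_mult_distrib
        flip: matrix_vector_mul_assoc)
  ultimately show ?thesis
    using norm2_transpose_mult_self_le[of R B] by simp
qed

lemma leverage_eq_norm_row: "leverage Q j = (norm (Q $ j))\<^sup>2"
proof -
  have "axis j 1 v* Q = Q $ j"
    by (simp add: vector_matrix_mult_def vec_eq_iff axis_def if_distrib[where f = "\<lambda>a. a * _"]
      cong: if_cong)
  then show ?thesis by (simp add: leverage_def)
qed

lemma leverage_nonneg: "0 \<le> leverage Q j"
  by (simp add: leverage_def)

lemma leverage_le_coherence: "leverage Q j \<le> coherence Q"
  by (simp add: coherence_def)

lemma component_sq_le_leverage: "((Q *v x) $ j)\<^sup>2 \<le> leverage Q j * (norm x)\<^sup>2"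
proof -
  have "(Q *v x) $ j = Q $ j \<bullet> x"
    by (simp add: matrix_vector_mult_def inner_vec_def)
  then show ?thesis
    using Cauchy_Schwarz_ineq[of "Q $ j" x] by (simp add: leverage_eq_norm_row power2_norm_eq_inner)
qed

text \<open>Both sides are the trace of \<open>transpose Q ** Q\<close>, that is, the sum of all
  squared entries of \<open>Q\<close>.\<close>

lemma sum_leverage:
  fixes Q :: "real^'n^'m"
  assumes "transpose Q ** Q = mat 1"
  shows "(\<Sum>j\<in>UNIV. leverage Q j) = CARD('n)"
proof -
  have "(\<Sum>j\<in>UNIV. leverage Q j) = (\<Sum>i\<in>UNIV. \<Sum>j\<in>UNIV. (Q $ j $ i)\<^sup>2)"
    by (simp add: leverage_eq_norm_row norm_sq_vec) (rule sum.swap)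
  also have "\<dots> = (\<Sum>i\<in>UNIV. (transpose Q ** Q) $ i $ i)"
    by (simp add: matrix_matrix_mult_def transpose_def power2_eq_square)
  finally show ?thesis by (simp add: assms mat_def)
qed

lemma norm_isometry:
  fixes Q :: "real^'n^'m"
  assumes "transpose Q ** Q = mat 1"
  shows "(norm (Q *v x))\<^sup>2 = (norm x)\<^sup>2"
  using inner_transpose_mult[of x Q "Q *v x"] assms
  by (simp add: power2_norm_eq_inner matrix_vector_mul_assoc)

text \<open>The largest score is at least the average one. This makes the coherence positive and
  keeps \<open>t\<close> at most \<open>CARD('m)\<close>, so \<open>\<sigma>\<close> is only
  evaluated where it is specified.\<close>

lemma one_le_card_mult_coherence:
  fixes Q :: "real^'n^'m"
  assumes "transpose Q ** Q = mat 1"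
  shows "1 \<le> CARD('m) * coherence Q"
proof -
  have "1 \<le> real CARD('n)"
    using zero_less_card_finite[where 'a = 'n] by linarith
  also have "\<dots> = (\<Sum>j\<in>UNIV. leverage Q j)"
    by (simp add: sum_leverage[OF assms])
  also have "\<dots> \<le> CARD('m) * coherence Q"
    by (rule sum_bounded_above) (rule leverage_le_coherence)
  finally show ?thesis .
qed

theorem corollary5p4:
  fixes Q :: "real^'n^'m" and l :: "'m \<Rightarrow> real" and \<mu> :: real
    and L :: "real^'m^'m" and \<sigma> :: "nat \<Rightarrow> 'm" and t :: nat
  assumes "transpose Q ** Q = mat 1"
    and "l = leverage Q"
    and "\<mu> = coherence Q"
    and "L = diag l"
    and "nonincreasing_labelling l \<sigma>"
    and "t = nat \<lfloor>1 / \<mu>\<rfloor>"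
  shows "norm2 (transpose Q ** L ** Q)
           \<le> \<mu> * (\<Sum>j=1..t. l (\<sigma> j)) + (if t = CARD('m) then 0 else (1 - real t * \<mu>) * l (\<sigma> (t + 1)))
       \<and> \<mu> * (\<Sum>j=1..t. l (\<sigma> j)) + (if t = CARD('m) then 0 else (1 - real t * \<mu>) * l (\<sigma> (t + 1))) \<le> \<mu>
       \<and> (1 / \<mu> \<in> \<int> \<longrightarrow> norm2 (transpose Q ** L ** Q) \<le> \<mu> * (\<Sum>j=1..t. l (\<sigma> j)))"
proof -
  have m\<mu>: "1 \<le> CARD('m) * \<mu>"
    using one_le_card_mult_coherence[OF assms(1)] assms(3) by simp
  then have \<mu>: "0 < \<mu>"
    by (metis less_le_trans of_nat_0_le_iff zero_less_mult_pos zero_less_one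
        zero_less_card_finite of_nat_0_less_iff)
  have t_le: "real t \<le> 1 / \<mu>"
    using \<mu> by (simp add: assms(6))
  have t\<mu>: "real t * \<mu> \<le> 1"
    using t_le \<mu> by (simp add: pos_le_divide_eq)
  have "1 / \<mu> \<le> CARD('m)"
    using m\<mu> \<mu> by (simp add: divide_le_eq)
  then have tm: "t \<le> CARD('m)"
    using t_le by linarith
  have l_nonneg: "0 \<le> l j" and l_le: "l j \<le> \<mu>" for j
    by (simp_all add: assms(2,3) leverage_nonneg leverage_le_coherence)
  have bij: "bij_betw \<sigma> {1..CARD('m)} UNIV"
    and anti: "\<And>i j. 1 \<le> i \<Longrightarrow> i \<le> j \<Longrightarrow> j \<le> CARD('m) \<Longrightarrow> l (\<sigma> j) \<le> l (\<sigma> i)"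
    using assms(5) by (auto simp: nonincreasing_labelling_def)
  define T where "T = \<sigma> ` {1..t}"
  \<comment> \<open>The threshold between the top \<open>t\<close> scores and the rest. For
    \<open>t = CARD('m)\<close> there is no rest, and the default 0 still lies below every
    score.\<close>
  define b where "b = (if t = CARD('m) then 0 else l (\<sigma> (t + 1)))"
  define B where "B = \<mu> * (\<Sum>j=1..t. l (\<sigma> j)) + (1 - real t * \<mu>) * b"
  have inj: "inj_on \<sigma> {1..t}"
    using bij tm by (auto simp: bij_betw_def intro: inj_on_subset)
  have b_le_T: "b \<le> l j" if "j \<in> T" for j
    using that tm l_nonneg anti[of _ "t + 1"] by (auto simp: T_def b_def)
  have le_b: "l j \<le> b" if "j \<notin> T" for j
  proof -
    obtain k where k: "k \<in> {1..CARD('m)}" "j = \<sigma> k"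
      using bij by (metis UNIV_I bij_betw_imp_surj_on imageE)
    with that have "t + 1 \<le> k"
      by (force simp: T_def)
    with k anti[of "t + 1" k] show ?thesis
      by (simp add: b_def)
  qed
  have "(\<Sum>j\<in>UNIV. l j * ((Q *v x) $ j)\<^sup>2) \<le> B * (norm x)\<^sup>2" for x
  proof -
    have "((Q *v x) $ j)\<^sup>2 \<le> \<mu> * (norm x)\<^sup>2" for j
      using component_sq_le_leverage[of Q x j] l_le[of j] assms(2)
      by (meson mult_right_mono order_trans zero_le_power2)
    \<comment> \<open>The cap is \<open>\<mu> * (norm x)\<^sup>2\<close>. Since the total weight is
      \<open>(norm x)\<^sup>2\<close> and \<open>card T = t\<close>, the remainder becomes
      \<open>(1 - real t * \<mu>) * (norm x)\<^sup>2\<close>.\<close>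
    then have "(\<Sum>j\<in>UNIV. l j * ((Q *v x) $ j)\<^sup>2) \<le> \<mu> * (norm x)\<^sup>2 * (\<Sum>j\<in>T. l j)
        + ((\<Sum>j\<in>UNIV. ((Q *v x) $ j)\<^sup>2) - real (card T) * (\<mu> * (norm x)\<^sup>2)) * b"
      using b_le_T le_b by (intro capped_weighted_sum_le) auto
    also have "\<dots> = B * (norm x)\<^sup>2"
      using inj
      by (simp add: norm_sq_vec[of "Q *v x", symmetric] norm_isometry[OF assms(1)] T_def card_image
          sum.reindex B_def algebra_simps)
    finally show ?thesis .
  qed
  then have norm_le: "norm2 (transpose Q ** L ** Q) \<le> B"
    unfolding assms(4) by (intro norm2_weighted_gram_le l_nonneg)
  have "(\<Sum>j=1..t. l (\<sigma> j)) \<le> real t * \<mu>"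
    using sum_bounded_above[of "{1..t}" "\<lambda>j. l (\<sigma> j)" \<mu>] l_le by simp
  moreover have "b \<le> \<mu>"
    using \<mu> l_le by (simp add: b_def)
  \<comment> \<open>Replacing every score by \<open>\<mu>\<close> leaves the weights
    \<open>real t * \<mu>\<close> and \<open>1 - real t * \<mu>\<close>, which add up to 1; the
    second is nonnegative by \<open>t\<mu>\<close>.\<close>
  ultimately have "B \<le> \<mu> * (real t * \<mu>) + (1 - real t * \<mu>) * \<mu>"
    unfolding B_def using \<mu> t\<mu> by (intro add_mono mult_left_mono) auto
  then have B_le: "B \<le> \<mu>"
    by (simp add: algebra_simps)
  \<comment> \<open>The floor is exact here, so \<open>real t * \<mu> = 1\<close> and the remainder
    term vanishes whatever \<open>b\<close> is.\<close>
  have integer: "B = \<mu> * (\<Sum>j=1..t. l (\<sigma> j))" if "1 / \<mu> \<in> \<int>"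
  proof -
    have "real t = 1 / \<mu>"
      using that \<mu> by (auto simp: assms(6) elim!: Ints_cases)
    with \<mu> show ?thesis by (simp add: B_def)
  qed
  have "B = \<mu> * (\<Sum>j=1..t. l (\<sigma> j))
      + (if t = CARD('m) then 0 else (1 - real t * \<mu>) * l (\<sigma> (t + 1)))"
    by (simp add: B_def b_def)
  with norm_le B_le integer show ?thesis by auto
qed

end
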